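(* Let $p=p(n)\in(0,1]$ and let $x=x(n)$ satisfy $x/(\log n/p)^2\to\infty$ as $n\to\infty$. For each $n$, fix a proper edge-colouring of the complete bipartite graph $K_{n,n}$ with bipartition classes $X$ and $Y$, and let $G$ be the random subgraph obtained by selecting each colour class independently with probability $p$ and keeping exactly the edges of selected colours. Then there is $\varepsilon(n)\to0$ such that, with probability tending to $1$, every vertex $v$ of $G$ has $(1-\varepsilon(n))np\le d_G(v)\le(1+\varepsilon(n))np$, and for every two subsets $A\subseteq X$, $B\subseteq Y$ with $|A|=|B|=x$ we have $e_G(A,B)\ge(1-\varepsilon(n))px^2$.
   Context: An edge-colouring is proper if edges sharing a vertex have distinct colours; a colour class is the set of edges of one colour. $e_G(A,B)$ denotes the number of edges of $G$ between $A$ and $B$, and $d_G(v)$ the degree of $v$ in $G$.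
   Formalization: The formal theorem takes x(n) to be a natural number with x(n) ≤ n for all large n (so that sets A, B of size x exist); without this the degree claim fails, e.g. for p = 1/n, x = n^10 and a colouring with n colours. *)

theory Defs
  imports "HOL-Probability.Probability" "HOL-Probability.Product_PMF"
begin

text \<open>Graphs are represented by their edge sets; an edge is the two-element set of its ends.\<close>

definition complete_bipartite :: "'a set \<Rightarrow> 'a set \<Rightarrow> 'a set set" where
  "complete_bipartite X Y = {{u, v} | u v. u \<in> X \<and> v \<in> Y}"

definition proper_edge_colouring :: "'a set set \<Rightarrow> ('a set \<Rightarrow> 'c) \<Rightarrow> bool" where
  "proper_edge_colouring E c \<longleftrightarrow>
     (\<forall>e\<in>E. \<forall>f\<in>E. e \<noteq> f \<longrightarrow> e \<inter> f \<noteq> {} \<longrightarrow> c e \<noteq> c f)"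

definition degree_in :: "'a set set \<Rightarrow> 'a \<Rightarrow> nat" where
  "degree_in G v = card {e \<in> G. v \<in> e}"

definition edges_between :: "'a set set \<Rightarrow> 'a set \<Rightarrow> 'a set \<Rightarrow> nat" where
  "edges_between G A B = card {e \<in> G. \<exists>a\<in>A. \<exists>b\<in>B. e = {a, b}}"

text \<open>The function \<open>s\<close> records which of the colours occurring on \<open>E\<close> are selected; the value
  \<open>False\<close> passed to \<open>Pi_pmf\<close> is only the default outside this set of colours.\<close>

definition random_colour_subgraph ::
    "'a set set \<Rightarrow> ('a set \<Rightarrow> 'c) \<Rightarrow> real \<Rightarrow> 'a set set pmf" where
  "random_colour_subgraph E c p =
     map_pmf (\<lambda>s. {e \<in> E. s (c e)}) (Pi_pmf (c ` E) False (\<lambda>_. bernoulli_pmf p))"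

end

theory Submission
  imports Defs
begin

text \<open>
  A direct union bound over all pairs \<open>A, B\<close> of size \<open>x\<close> is hopeless, since one colour may cover
  \<open>x\<close> of the \<open>x\<^sup>2\<close> edges. Instead, sample \<open>s\<close> vertices of \<open>A\<close> and \<open>s\<close> vertices of \<open>B\<close> uniformly
  with replacement. As the colouring is proper, two different cells of the \<open>s \<times> s\<close> sample have
  the same colour with probability at most \<open>1 / x\<close>, so the sample shows on average at least
  \<open>s\<^sup>2 (1 - s\<^sup>2 / x)\<close> colours. By Chernoff and a union bound over only \<open>n ^ (2 s)\<close> samples, with high
  probability every sample has at least its expected number of selected colours up to an error
  \<open>\<epsilon> p s\<^sup>2\<close>, provided that \<open>p s\<close> is much larger than \<open>log n\<close>. Averaging over all samples of
  \<open>A, B\<close> then bounds \<open>e(A, B)\<close> from below. Both conditions on \<open>s\<close> can be met exactly when \<open>x\<close> is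
  much larger than \<open>(log n / p)\<^sup>2\<close>; the degrees are handled by Chernoff alone.
\<close>

section \<open>Tails of the number of selected colours\<close>

text \<open>A bound valid for both signs of \<open>t\<close> serves both tails. For negative
  \<open>t\<close>, invert the Taylor lower bound for \<open>exp (-t)\<close>: the product of the
  two quadratics is at least 1.\<close>

lemma exp_le_quadratic:
  fixes t :: real
  assumes "\<bar>t\<bar> \<le> 1"
  shows "exp t \<le> 1 + t + t\<^sup>2"
proof (cases "t \<ge> 0")
  case True
  then show ?thesis using assms exp_bound[of t] by simp
next
  case False
  then have t: "t < 0" by simp
  have "1 - t + t\<^sup>2 / 2 \<le> exp (-t)"
    using exp_lower_Taylor_quadratic[of "-t"] t by simp
  moreover have "0 < 1 - t + t\<^sup>2 / 2" using t by (simp add: add_pos_nonneg)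
  ultimately have "exp t \<le> 1 / (1 - t + t\<^sup>2 / 2)"
    by (simp add: exp_minus field_simps)
  also have "\<dots> \<le> 1 + t + t\<^sup>2"
  proof -
    have "(1 + t + t\<^sup>2) * (1 - t + t\<^sup>2 / 2) = 1 + t\<^sup>2 / 2 * (1 - t + t\<^sup>2)"
      by (simp add: field_simps power2_eq_square)
    moreover have "0 \<le> t\<^sup>2 / 2 * (1 - t + t\<^sup>2)" using t by simp
    ultimately show ?thesis using \<open>0 < 1 - t + t\<^sup>2 / 2\<close>
      by (simp add: pos_divide_le_eq)
  qed
  finally show ?thesis .
qed

text \<open>Independence factors the moment generating function, and each factor
  \<open>1 + p * (exp t - 1)\<close> is at most \<open>exp (p * (t + t\<^sup>2))\<close>. Since the
  sign of \<open>t\<close> is left open, one exponential Markov estimate yields both tails.\<close>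

lemma Pi_pmf_bernoulli_exp_Markov:
  fixes p t z :: real
  assumes fin: "finite K" and sub: "C \<subseteq> K" and p: "0 \<le> p" "p \<le> 1" and t: "\<bar>t\<bar> \<le> 1"
  shows "measure_pmf.prob (Pi_pmf K False (\<lambda>_. bernoulli_pmf p))
           {s. z \<le> t * real (card {k \<in> C. s k})}
         \<le> exp (p * real (card C) * (t + t\<^sup>2) - z)"
proof -
  let ?M = "Pi_pmf K False (\<lambda>_. bernoulli_pmf p)"
  \<comment> \<open>Colours outside \<open>C\<close> get the factor 1, so the product can run over
    all of \<open>K\<close>, the index set of the product measure.\<close>
  define f where "f = (\<lambda>k b. if k \<in> C \<and> b then exp t else (1::real))"
  have finC: "finite C" using fin sub by (rule finite_subset[rotated])
  have eq: "exp (t * real (card {k \<in> C. s k})) = (\<Prod>k\<in>K. f k (s k))" for s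
  proof -
    have "(\<Prod>k\<in>K. f k (s k)) = (\<Prod>k\<in>{k \<in> C. s k}. exp t)"
      unfolding f_def using fin sub by (intro prod.mono_neutral_cong_right) auto
    also have "\<dots> = exp (t * real (card {k \<in> C. s k}))"
      by (simp add: exp_of_nat_mult[symmetric] mult.commute)
    finally show ?thesis by simp
  qed
  have int: "integrable (measure_pmf (bernoulli_pmf p)) (f k)" for k
    by (intro integrable_measure_pmf_finite) simp
  have "measure_pmf.prob ?M {s. z \<le> t * real (card {k \<in> C. s k})}
      = measure_pmf.prob ?M {s \<in> space ?M. exp z \<le> (\<Prod>k\<in>K. f k (s k))}"
    by (simp flip: eq)
  also have "\<dots> \<le> measure_pmf.expectation ?M (\<lambda>s. \<Prod>k\<in>K. f k (s k)) / exp z"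
    by (intro integral_Markov_inequality_measure[where A="{}"] integrable_prod_Pi_pmf fin int)
       (auto simp: f_def intro!: AE_pmfI prod_nonneg)
  also have "measure_pmf.expectation ?M (\<lambda>s. \<Prod>k\<in>K. f k (s k))
      = (\<Prod>k\<in>K. measure_pmf.expectation (bernoulli_pmf p) (f k))"
    by (intro expectation_prod_Pi_pmf fin int) (auto simp: f_def)
  also have "\<dots> = (\<Prod>k\<in>C. 1 + p * (exp t - 1))"
    using fin sub p by (intro prod.mono_neutral_cong_right) (auto simp: f_def algebra_simps)
  also have "\<dots> \<le> (\<Prod>k\<in>C. exp (p * (t + t\<^sup>2)))"
  proof (intro prod_mono conjI)
    have "0 \<le> (1 - p) + p * exp t" using p by simp
    then show "0 \<le> 1 + p * (exp t - 1)" by (simp add: algebra_simps)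
    have "p * (exp t - 1) \<le> p * (t + t\<^sup>2)"
      using exp_le_quadratic[OF t] p by (intro mult_left_mono) auto
    then show "1 + p * (exp t - 1) \<le> exp (p * (t + t\<^sup>2))"
      using exp_ge_add_one_self[of "p * (t + t\<^sup>2)"] by linarith
  qed
  also have "\<dots> = exp (p * real (card C) * (t + t\<^sup>2))"
    by (simp add: exp_of_nat_mult[symmetric] mult_ac)
  finally show ?thesis by (simp add: exp_diff divide_right_mono)
qed

text \<open>Take \<open>t = - (\<delta> / 2)\<close>; the bound \<open>\<delta> \<le> 2\<close>
  keeps it in range. The deviation is measured against an upper bound \<open>m\<close> of
  \<open>card C\<close> because samples show varying numbers of colours, while the failure
  probability has to be uniform.\<close>

lemma Pi_pmf_bernoulli_lower_tail:
  fixes p \<delta> m :: real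
  assumes "finite K" "C \<subseteq> K" "0 \<le> p" "p \<le> 1" "0 \<le> \<delta>" "\<delta> \<le> 2" and m: "real (card C) \<le> m"
  shows "measure_pmf.prob (Pi_pmf K False (\<lambda>_. bernoulli_pmf p))
           {s. real (card {k \<in> C. s k}) \<le> p * real (card C) - \<delta> * p * m}
         \<le> exp (- (\<delta>\<^sup>2 * p * m / 4))"
proof -
  let ?z = "- (\<delta> / 2) * (p * real (card C) - \<delta> * p * m)"
  have "measure_pmf.prob (Pi_pmf K False (\<lambda>_. bernoulli_pmf p))
           {s. real (card {k \<in> C. s k}) \<le> p * real (card C) - \<delta> * p * m}
      \<le> measure_pmf.prob (Pi_pmf K False (\<lambda>_. bernoulli_pmf p))
           {s. ?z \<le> - (\<delta> / 2) * real (card {k \<in> C. s k})}"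
    using assms by (intro measure_pmf.finite_measure_mono) (auto intro!: mult_left_mono)
  also have "\<dots> \<le> exp (p * real (card C) * (- (\<delta> / 2) + (- (\<delta> / 2))\<^sup>2) - ?z)"
    using assms by (intro Pi_pmf_bernoulli_exp_Markov) auto
  also have "\<dots> \<le> exp (- (\<delta>\<^sup>2 * p * m / 4))"
  proof -
    have "p * real (card C) * \<delta>\<^sup>2 \<le> p * m * \<delta>\<^sup>2"
      using assms by (intro mult_right_mono mult_left_mono) auto
    then show ?thesis by (simp add: algebra_simps power2_eq_square)
  qed
  finally show ?thesis .
qed

text \<open>The same computation with \<open>t = \<delta> / 2\<close>. It serves the degrees, where
  \<open>card C\<close> is known exactly.\<close>

lemma Pi_pmf_bernoulli_upper_tail:
  fixes p \<delta> :: real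
  assumes "finite K" "C \<subseteq> K" "0 \<le> p" "p \<le> 1" "0 \<le> \<delta>" "\<delta> \<le> 2"
  shows "measure_pmf.prob (Pi_pmf K False (\<lambda>_. bernoulli_pmf p))
           {s. p * real (card C) + \<delta> * p * real (card C) \<le> real (card {k \<in> C. s k})}
         \<le> exp (- (\<delta>\<^sup>2 * p * real (card C) / 4))"
proof -
  let ?z = "\<delta> / 2 * (p * real (card C) + \<delta> * p * real (card C))"
  have "measure_pmf.prob (Pi_pmf K False (\<lambda>_. bernoulli_pmf p))
           {s. p * real (card C) + \<delta> * p * real (card C) \<le> real (card {k \<in> C. s k})}
      \<le> measure_pmf.prob (Pi_pmf K False (\<lambda>_. bernoulli_pmf p))
           {s. ?z \<le> \<delta> / 2 * real (card {k \<in> C. s k})}"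
    using assms by (intro measure_pmf.finite_measure_mono) (auto intro!: mult_left_mono)
  also have "\<dots> \<le> exp (p * real (card C) * (\<delta> / 2 + (\<delta> / 2)\<^sup>2) - ?z)"
    using assms by (intro Pi_pmf_bernoulli_exp_Markov) auto
  also have "\<dots> = exp (- (\<delta>\<^sup>2 * p * real (card C) / 4))"
    by (simp add: algebra_simps power2_eq_square)
  finally show ?thesis .
qed

section \<open>Sampling from a properly coloured square\<close>

text \<open>Keep one representative of each value. Every other element collides with its
  representative, and these ordered pairs differ in their first entries.\<close>

lemma card_le_card_image_plus_collisions:
  assumes fin: "finite J"
  shows "card J \<le> card (h ` J) + card {(u, v) \<in> J \<times> J. u \<noteq> v \<and> h u = h v}"
proof -
  define r where "r = inv_into J h"
  let ?R = "r ` h ` J"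
  have r: "r (h u) \<in> J" "h (r (h u)) = h u" if "u \<in> J" for u
    using that by (auto simp: r_def inv_into_into f_inv_into_f)
  have sub: "?R \<subseteq> J" using r by auto
  have "card (J - ?R) \<le> card {(u, v) \<in> J \<times> J. u \<noteq> v \<and> h u = h v}"
  proof (rule card_inj_on_le[where f = "\<lambda>u. (u, r (h u))"])
    show "finite {(u, v) \<in> J \<times> J. u \<noteq> v \<and> h u = h v}"
      by (rule finite_subset[of _ "J \<times> J"]) (use fin in auto)
  qed (use r in \<open>auto simp: inj_on_def\<close>)
  moreover have "card J = card (J - ?R) + card ?R"
    using fin sub by (metis card_Diff_subset card_mono finite_subset le_add_diff_inverse2)
  moreover have "card ?R \<le> card (h ` J)" using fin by (intro card_image_le) auto
  ultimately show ?thesis by linarith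
qed

section \<open>Counting functions and pairs of functions\<close>

text \<open>If the \<open>i\<close>-th value of every function in \<open>P\<close> is determined by the other values, then
  changing that value arbitrarily blows \<open>P\<close> up by a factor of \<open>card A\<close>.\<close>

lemma card_determined_coordinate_le:
  assumes fin: "finite I" "finite A" and i: "i \<in> I" and sub: "P \<subseteq> I \<rightarrow>\<^sub>E A"
    and det: "\<And>f a. f \<in> P \<Longrightarrow> f(i := a) \<in> P \<Longrightarrow> a = f i"
  shows "card P * card A \<le> card A ^ card I"
proof -
  have "card (P \<times> A) \<le> card (I \<rightarrow>\<^sub>E A)"
  proof (rule card_inj_on_le[where f = "\<lambda>(f, a). f(i := a)"])
    show "inj_on (\<lambda>(f, a). f(i := a)) (P \<times> A)"
    proof (rule inj_onI, clarsimp)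
      fix f a g b
      assume P: "f \<in> P" "g \<in> P" and eq: "f(i := a) = g(i := b)"
      have "f j = g j" if "j \<noteq> i" for j
        using fun_cong[OF eq, of j] that by simp
      then have g: "g = f(i := g i)" by auto
      then have "g i = f i" using det P by metis
      then show "f = g \<and> a = b" using g fun_cong[OF eq, of i] by simp
    qed
    show "(\<lambda>(f, a). f(i := a)) ` (P \<times> A) \<subseteq> I \<rightarrow>\<^sub>E A"
      using sub i by (auto simp: PiE_iff extensional_def Pi_iff)
  qed (use fin in \<open>auto intro: finite_PiE\<close>)
  then show ?thesis using fin by (simp add: card_cartesian_product card_PiE)
qed

lemma card_PiE_fixed_value_le:
  assumes "finite I" "finite A" "i \<in> I"
  shows "card {f \<in> I \<rightarrow>\<^sub>E A. f i = a} * card A \<le> card A ^ card I"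
  using assms by (intro card_determined_coordinate_le) auto


text \<open>Conditioning on the first component: a bound that holds in every fibre survives
  summation. Keeping the factor \<open>x\<close> on the left avoids division of natural
  numbers.\<close>

lemma card_pairs_mult_le:
  assumes fin: "finite F" "finite G"
    and le: "\<And>f. f \<in> F \<Longrightarrow> card {g \<in> G. P f g} * x \<le> m"
  shows "card {z \<in> F \<times> G. P (fst z) (snd z)} * x \<le> card F * m"
proof -
  have "{z \<in> F \<times> G. P (fst z) (snd z)} = Sigma F (\<lambda>f. {g \<in> G. P f g})" by auto
  then have "card {z \<in> F \<times> G. P (fst z) (snd z)} * x = (\<Sum>f\<in>F. card {g \<in> G. P f g} * x)"
    using fin by (simp add: sum_distrib_right)
  also have "\<dots> \<le> (\<Sum>f\<in>F. m)" by (intro sum_mono le)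
  finally show ?thesis by simp
qed

lemma card_pairs_mult_le':
  assumes fin: "finite F" "finite G"
    and le: "\<And>g. g \<in> G \<Longrightarrow> card {f \<in> F. P f g} * x \<le> m"
  shows "card {z \<in> F \<times> G. P (fst z) (snd z)} * x \<le> card G * m"
proof -
  have "{z \<in> F \<times> G. P (fst z) (snd z)} = prod.swap ` {z \<in> G \<times> F. P (snd z) (fst z)}"
    by (auto simp: image_iff)
  then have "card {z \<in> F \<times> G. P (fst z) (snd z)} = card {z \<in> G \<times> F. P (snd z) (fst z)}"
    by (simp add: card_image)
  then show ?thesis
    using card_pairs_mult_le[of G F "\<lambda>g f. P f g" x m] assms by simp
qed

text \<open>Properness of the colouring is used only in this form: each row and each column of the
  array of colours is injective.\<close>

locale latin_square_sample =
  fixes A :: "'a set" and B :: "'b set" and col :: "'a \<Rightarrow> 'b \<Rightarrow> 'c" and x s :: nat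
  assumes finite_A: "finite A" and finite_B: "finite B"
    and card_A: "card A = x" and card_B: "card B = x" and x_pos: "0 < x"
    and row_inj: "\<And>a. a \<in> A \<Longrightarrow> inj_on (col a) B"
    and column_inj: "\<And>b. b \<in> B \<Longrightarrow> inj_on (\<lambda>a. col a b) A"
begin

definition samples :: "((nat \<Rightarrow> 'a) \<times> (nat \<Rightarrow> 'b)) set" where
  "samples = ({..<s} \<rightarrow>\<^sub>E A) \<times> ({..<s} \<rightarrow>\<^sub>E B)"

text \<open>Cells are positions rather than edges. Sampling with replacement can repeat a vertex, so
  two positions may show the same edge; this also counts as a collision.\<close>

definition cells :: "(nat \<times> nat) set" where
  "cells = {..<s} \<times> {..<s}"

definition sample_colour :: "(nat \<Rightarrow> 'a) \<times> (nat \<Rightarrow> 'b) \<Rightarrow> nat \<times> nat \<Rightarrow> 'c" where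
  "sample_colour z u = col (fst z (fst u)) (snd z (snd u))"

section \<open>First-moment counts over all samples\<close>

lemma finite_samples: "finite samples"
  unfolding samples_def using finite_A finite_B by (auto intro: finite_PiE)

lemma card_samples: "card samples = x ^ s * x ^ s"
  unfolding samples_def using card_A card_B by (simp add: card_cartesian_product card_PiE)

lemma finite_cells: "finite cells"
  by (simp add: cells_def)

lemma card_cells: "card cells = s\<^sup>2"
  by (simp add: cells_def card_cartesian_product power2_eq_square)

lemma PiE_A_mem: "f \<in> {..<s} \<rightarrow>\<^sub>E A \<Longrightarrow> i < s \<Longrightarrow> f i \<in> A"
  and PiE_B_mem: "g \<in> {..<s} \<rightarrow>\<^sub>E B \<Longrightarrow> i < s \<Longrightarrow> g i \<in> B"
  by (simp_all add: PiE_iff)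

text \<open>If \<open>u\<close> and \<open>v\<close> lie in different columns, changing the column
  vertex of \<open>v\<close> leaves the colour at \<open>u\<close> alone, and row injectivity
  determines that vertex from the rest of the sample. If the columns agree, the rows differ and the
  row vertex of \<open>v\<close> is determined by column injectivity.\<close>

lemma card_colliding_samples_le:
  assumes u: "u \<in> cells" and v: "v \<in> cells" and uv: "u \<noteq> v"
  shows "card {z \<in> samples. sample_colour z u = sample_colour z v} * x \<le> x ^ s * x ^ s"
proof -
  obtain i j where u_eq: "u = (i, j)" by fastforce
  obtain i' j' where v_eq: "v = (i', j')" by fastforce
  let ?F = "{..<s} \<rightarrow>\<^sub>E A" and ?G = "{..<s} \<rightarrow>\<^sub>E B"
  have idx: "i < s" "j < s" "i' < s" "j' < s"
    using u v by (auto simp: u_eq v_eq cells_def)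
  have fin: "finite ?F" "finite ?G" using finite_A finite_B by (auto intro: finite_PiE)
  have card: "card ?F = x ^ s" "card ?G = x ^ s" using card_A card_B by (simp_all add: card_PiE)
  show ?thesis
  proof (cases "j = j'")
    case False
    have "card {g \<in> ?G. col (f i) (g j) = col (f i') (g j')} * x \<le> x ^ s" if f: "f \<in> ?F" for f
    proof -
      have "card {g \<in> ?G. col (f i) (g j) = col (f i') (g j')} * card B \<le> card B ^ card {..<s}"
      proof (rule card_determined_coordinate_le[where i = j'])
        fix g b
        assume "g \<in> {g \<in> ?G. col (f i) (g j) = col (f i') (g j')}"
          and "g(j' := b) \<in> {g \<in> ?G. col (f i) (g j) = col (f i') (g j')}"
        then have "col (f i') b = col (f i') (g j')" "g j' \<in> B" "b \<in> B"
          using False idx PiE_B_mem[of g j'] PiE_B_mem[of "g(j' := b)" j'] by simp_all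
        then show "b = g j'" using row_inj[OF PiE_A_mem[OF f idx(3)]] by (simp add: inj_on_eq_iff)
      qed (use finite_B idx in auto)
      then show ?thesis by (simp add: card_B)
    qed
    from card_pairs_mult_le[OF fin this] show ?thesis
      by (simp add: samples_def sample_colour_def u_eq v_eq card)
  next
    case True
    with uv have "i \<noteq> i'" by (simp add: u_eq v_eq)
    have "card {f \<in> ?F. col (f i) (g j) = col (f i') (g j')} * x \<le> x ^ s" if g: "g \<in> ?G" for g
    proof -
      have "card {f \<in> ?F. col (f i) (g j) = col (f i') (g j')} * card A \<le> card A ^ card {..<s}"
      proof (rule card_determined_coordinate_le[where i = i'])
        fix f a
        assume "f \<in> {f \<in> ?F. col (f i) (g j) = col (f i') (g j')}"
          and "f(i' := a) \<in> {f \<in> ?F. col (f i) (g j) = col (f i') (g j')}"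
        then have "col a (g j') = col (f i') (g j')" "f i' \<in> A" "a \<in> A"
          using True \<open>i \<noteq> i'\<close> idx PiE_A_mem[of f i'] PiE_A_mem[of "f(i' := a)" i'] by simp_all
        then show "a = f i'" using inj_onD[OF column_inj[OF PiE_B_mem[OF g idx(4)]]] by blast
      qed (use finite_A idx in auto)
      then show ?thesis by (simp add: card_A)
    qed
    from card_pairs_mult_le'[OF fin this] show ?thesis
      by (simp add: samples_def sample_colour_def u_eq v_eq card)
  qed
qed

text \<open>Exchange the sums: there are \<open>s ^ 4\<close> ordered pairs of cells, each colliding
  in at most a fraction \<open>1 / x\<close> of the samples. Pairs of equal cells contribute
  nothing.\<close>

lemma sum_collisions_le:
  "(\<Sum>z\<in>samples. card {q \<in> cells \<times> cells. fst q \<noteq> snd q \<and>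
      sample_colour z (fst q) = sample_colour z (snd q)}) * x \<le> s ^ 4 * (x ^ s * x ^ s)"
proof -
  let ?R = "\<lambda>z q. fst q \<noteq> snd q \<and> sample_colour z (fst q) = sample_colour z (snd q)"
  have "(\<Sum>z\<in>samples. card {q \<in> cells \<times> cells. ?R z q})
      = (\<Sum>q\<in>cells \<times> cells. card {z \<in> samples. ?R z q})"
    by (intro sum_multicount_gen finite_samples finite_cartesian_product finite_cells) simp
  also have "\<dots> * x = (\<Sum>q\<in>cells \<times> cells. card {z \<in> samples. ?R z q} * x)"
    by (simp add: sum_distrib_right)
  also have "\<dots> \<le> (\<Sum>q\<in>cells \<times> cells. x ^ s * x ^ s)"
  proof (rule sum_mono)
    fix q assume q: "q \<in> cells \<times> cells"
    show "card {z \<in> samples. ?R z q} * x \<le> x ^ s * x ^ s"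
    proof (cases "fst q = snd q")
      case False
      then show ?thesis using q card_colliding_samples_le[of "fst q" "snd q"] by auto
    qed simp
  qed
  also have "\<dots> = s ^ 4 * (x ^ s * x ^ s)"
    by (simp add: card_cartesian_product card_cells flip: power_add)
  finally show ?thesis .
qed

text \<open>A single cell of a uniform sample is a uniform pair in \<open>A \<times> B\<close>.
  Splitting by this pair fixes one value of each of the two functions, which costs a factor
  \<open>x\<close> twice.\<close>

lemma card_samples_hitting_le:
  assumes u: "u \<in> cells"
  shows "card {z \<in> samples. Q (sample_colour z u)} * x\<^sup>2
         \<le> card {(a, b) \<in> A \<times> B. Q (col a b)} * (x ^ s * x ^ s)"
proof -
  obtain i j where u_eq: "u = (i, j)" by fastforce
  have idx: "i < s" "j < s" using u by (auto simp: u_eq cells_def)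
  let ?E = "{(a, b) \<in> A \<times> B. Q (col a b)}"
  let ?F = "\<lambda>a. {f \<in> {..<s} \<rightarrow>\<^sub>E A. f i = a}" and ?G = "\<lambda>b. {g \<in> {..<s} \<rightarrow>\<^sub>E B. g j = b}"
  have finE: "finite ?E"
    by (rule finite_subset[of _ "A \<times> B"]) (use finite_A finite_B in auto)
  have "{z \<in> samples. Q (sample_colour z u)} \<subseteq> (\<Union>e\<in>?E. ?F (fst e) \<times> ?G (snd e))"
  proof
    fix z assume "z \<in> {z \<in> samples. Q (sample_colour z u)}"
    then have z: "fst z \<in> {..<s} \<rightarrow>\<^sub>E A" "snd z \<in> {..<s} \<rightarrow>\<^sub>E B" "Q (col (fst z i) (snd z j))"
      by (simp_all add: samples_def sample_colour_def u_eq mem_Times_iff)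
    then have "(fst z i, snd z j) \<in> ?E" using idx PiE_A_mem PiE_B_mem by simp
    then show "z \<in> (\<Union>e\<in>?E. ?F (fst e) \<times> ?G (snd e))"
      using z by (intro UN_I[of "(fst z i, snd z j)"]) (simp_all add: mem_Times_iff)
  qed
  then have "card {z \<in> samples. Q (sample_colour z u)} \<le> card (\<Union>e\<in>?E. ?F (fst e) \<times> ?G (snd e))"
    using finE finite_A finite_B
    by (intro card_mono finite_UN_I finite_cartesian_product finite_Collect_conjI disjI1)
      (simp_all add: finite_PiE)
  also have "\<dots> \<le> (\<Sum>e\<in>?E. card (?F (fst e) \<times> ?G (snd e)))"
    using finE by (rule card_UN_le)
  finally have "card {z \<in> samples. Q (sample_colour z u)} * x\<^sup>2
      \<le> (\<Sum>e\<in>?E. card (?F (fst e) \<times> ?G (snd e))) * x\<^sup>2"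
    by (rule mult_right_mono) simp
  also have "\<dots> = (\<Sum>e\<in>?E. (card (?F (fst e)) * x) * (card (?G (snd e)) * x))"
    by (simp add: sum_distrib_left card_cartesian_product power2_eq_square mult_ac)
  also have "\<dots> \<le> (\<Sum>e\<in>?E. x ^ s * x ^ s)"
  proof (intro sum_mono mult_mono)
    fix e :: "'a \<times> 'b"
    show "card (?F (fst e)) * x \<le> x ^ s"
      using card_PiE_fixed_value_le[of "{..<s}" A i "fst e"] idx finite_A card_A by simp
    show "card (?G (snd e)) * x \<le> x ^ s"
      using card_PiE_fixed_value_le[of "{..<s}" B j "snd e"] idx finite_B card_B by simp
  qed auto
  finally show ?thesis by simp
qed

lemma sum_hits_le:
  "(\<Sum>z\<in>samples. card {u \<in> cells. Q (sample_colour z u)}) * x\<^sup>2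
   \<le> s\<^sup>2 * (card {(a, b) \<in> A \<times> B. Q (col a b)} * (x ^ s * x ^ s))"
proof -
  have "(\<Sum>z\<in>samples. card {u \<in> cells. Q (sample_colour z u)})
      = (\<Sum>u\<in>cells. card {z \<in> samples. Q (sample_colour z u)})"
    by (intro sum_multicount_gen finite_samples finite_cells) simp
  also have "\<dots> * x\<^sup>2 = (\<Sum>u\<in>cells. card {z \<in> samples. Q (sample_colour z u)} * x\<^sup>2)"
    by (simp add: sum_distrib_right)
  also have "\<dots> \<le> (\<Sum>u\<in>cells. card {(a, b) \<in> A \<times> B. Q (col a b)} * (x ^ s * x ^ s))"
    by (intro sum_mono card_samples_hitting_le)
  finally show ?thesis by (simp add: card_cells)
qed

text \<open>A deterministic averaging argument: the random choice of colours has to supply only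
  \<open>sel\<close>. The selected cells, summed over all samples, are bounded below by distinct
  selected colours and above by \<open>sum_hits_le\<close>; then the number of samples
  cancels.\<close>

lemma card_selected_ge:
  fixes p \<delta> :: real
  assumes p: "0 \<le> p"
    and sel: "\<And>z. z \<in> samples \<Longrightarrow> p * real (card (sample_colour z ` cells)) - \<delta>
                \<le> real (card {k \<in> sample_colour z ` cells. Q k})"
  shows "(real x)\<^sup>2 * (p * ((real s)\<^sup>2 - real s ^ 4 / real x) - \<delta>)
         \<le> (real s)\<^sup>2 * real (card {(a, b) \<in> A \<times> B. Q (col a b)})"
proof -
  define N where "N = real x ^ s * real x ^ s"
  have N: "N > 0" using x_pos by (simp add: N_def)
  define coll where "coll z = card {q \<in> cells \<times> cells. fst q \<noteq> snd q \<and>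
      sample_colour z (fst q) = sample_colour z (snd q)}" for z
  let ?e = "real (card {(a, b) \<in> A \<times> B. Q (col a b)})"
  have samples: "real (card samples) = N" by (simp add: card_samples N_def)
  have "real ((\<Sum>z\<in>samples. coll z) * x) \<le> real (s ^ 4 * (x ^ s * x ^ s))"
    using sum_collisions_le unfolding coll_def by (simp only: of_nat_le_iff)
  then have coll: "(\<Sum>z\<in>samples. real (coll z)) \<le> real s ^ 4 / real x * N"
    using x_pos by (simp add: N_def field_simps)
  have "p * ((real s)\<^sup>2 - real (coll z)) - \<delta> \<le> real (card {u \<in> cells. Q (sample_colour z u)})"
    if z: "z \<in> samples" for z
  proof -
    have "{(u, v) \<in> cells \<times> cells. u \<noteq> v \<and> sample_colour z u = sample_colour z v}
        = {q \<in> cells \<times> cells. fst q \<noteq> snd q \<and> sample_colour z (fst q) = sample_colour z (snd q)}"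
      by auto
    then have "s\<^sup>2 \<le> card (sample_colour z ` cells) + coll z"
      using card_le_card_image_plus_collisions[OF finite_cells, of "sample_colour z"]
      by (simp add: card_cells coll_def)
    then have "real (s\<^sup>2) \<le> real (card (sample_colour z ` cells) + coll z)"
      by (simp only: of_nat_le_iff)
    then have "p * ((real s)\<^sup>2 - real (coll z)) \<le> p * real (card (sample_colour z ` cells))"
      using p by (intro mult_left_mono) auto
    \<comment> \<open>Each selected colour on show occupies at least one cell, so counting colours
      instead of cells loses in the safe direction.\<close>
    moreover have "{k \<in> sample_colour z ` cells. Q k}
        = sample_colour z ` {u \<in> cells. Q (sample_colour z u)}" by auto
    then have "card {k \<in> sample_colour z ` cells. Q k} \<le> card {u \<in> cells. Q (sample_colour z u)}"
      using finite_cells by (simp add: card_image_le)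
    ultimately show ?thesis using sel[OF z] by linarith
  qed
  then have "(\<Sum>z\<in>samples. p * ((real s)\<^sup>2 - real (coll z)) - \<delta>)
      \<le> (\<Sum>z\<in>samples. real (card {u \<in> cells. Q (sample_colour z u)}))"
    by (rule sum_mono)
  moreover have "(\<Sum>z\<in>samples. p * ((real s)\<^sup>2 - real (coll z)) - \<delta>)
      = p * ((real s)\<^sup>2 * N - (\<Sum>z\<in>samples. real (coll z))) - \<delta> * N"
    by (simp add: sum_subtractf samples mult.commute flip: sum_distrib_left)
  \<comment> \<open>Collisions enter linearly, so a bound on their average over all samples
    suffices.\<close>
  moreover have "p * ((real s)\<^sup>2 * N - real s ^ 4 / real x * N)
      \<le> p * ((real s)\<^sup>2 * N - (\<Sum>z\<in>samples. real (coll z)))"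
    using coll p by (intro mult_left_mono) auto
  ultimately have low: "N * (p * ((real s)\<^sup>2 - real s ^ 4 / real x) - \<delta>)
      \<le> (\<Sum>z\<in>samples. real (card {u \<in> cells. Q (sample_colour z u)}))"
    by (simp add: algebra_simps)
  have "real ((\<Sum>z\<in>samples. card {u \<in> cells. Q (sample_colour z u)}) * x\<^sup>2)
      \<le> real (s\<^sup>2 * (card {(a, b) \<in> A \<times> B. Q (col a b)} * (x ^ s * x ^ s)))"
    using sum_hits_le by (simp only: of_nat_le_iff)
  then have "(\<Sum>z\<in>samples. real (card {u \<in> cells. Q (sample_colour z u)})) * (real x)\<^sup>2
      \<le> (real s)\<^sup>2 * (?e * N)"
    by (simp add: N_def)
  with mult_right_mono[OF low, of "(real x)\<^sup>2"]
  have "N * (p * ((real s)\<^sup>2 - real s ^ 4 / real x) - \<delta>) * (real x)\<^sup>2 \<le> (real s)\<^sup>2 * (?e * N)"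
    by simp
  then have "N * ((real x)\<^sup>2 * (p * ((real s)\<^sup>2 - real s ^ 4 / real x) - \<delta>)) \<le> N * ((real s)\<^sup>2 * ?e)"
    by (simp only: mult_ac)
  then show ?thesis using N by (simp only: mult_le_cancel_left_pos)
qed

end


section \<open>The random subgraph\<close>

lemma finite_complete_bipartite:
  assumes "finite X" "finite Y"
  shows "finite (complete_bipartite X Y)"
proof -
  have "complete_bipartite X Y = (\<lambda>(u, v). {u, v}) ` (X \<times> Y)"
    by (auto simp: complete_bipartite_def)
  then show ?thesis using assms by simp
qed

lemma card_incident_complete_bipartite:
  assumes "finite X" "finite Y" "card X = n" "card Y = n" and disj: "X \<inter> Y = {}"
    and v: "v \<in> X \<union> Y"
  shows "card {e \<in> complete_bipartite X Y. v \<in> e} = n"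
proof (cases "v \<in> X")
  case True
  then have "{e \<in> complete_bipartite X Y. v \<in> e} = (\<lambda>b. {v, b}) ` Y"
    using disj by (auto simp: complete_bipartite_def)
  moreover have "inj_on (\<lambda>b. {v, b}) Y" by (auto simp: inj_on_def doubleton_eq_iff)
  ultimately show ?thesis using assms by (simp add: card_image)
next
  case False
  then have "{e \<in> complete_bipartite X Y. v \<in> e} = (\<lambda>a. {a, v}) ` X"
    using disj v by (auto simp: complete_bipartite_def)
  moreover have "inj_on (\<lambda>a. {a, v}) X" by (auto simp: inj_on_def doubleton_eq_iff)
  ultimately show ?thesis using assms by (simp add: card_image)
qed

lemma proper_edge_colouring_inj_on_incident:
  assumes "proper_edge_colouring E c"
  shows "inj_on c {e \<in> E. v \<in> e}"
  using assms unfolding proper_edge_colouring_def inj_on_def by blast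

text \<open>Edges at a vertex have distinct colours, so a degree counts independently selected
  colours and the tail bounds apply directly.\<close>

lemma degree_in_selected:
  assumes "proper_edge_colouring E c"
  shows "degree_in {e \<in> E. S (c e)} v = card {k \<in> c ` {e \<in> E. v \<in> e}. S k}"
proof -
  have "{k \<in> c ` {e \<in> E. v \<in> e}. S k} = c ` {e \<in> {e \<in> E. S (c e)}. v \<in> e}" by auto
  moreover have "inj_on c {e \<in> {e \<in> E. S (c e)}. v \<in> e}"
    by (rule inj_on_subset[OF proper_edge_colouring_inj_on_incident[OF assms, of v]]) auto
  ultimately show ?thesis by (simp add: degree_in_def card_image)
qed

text \<open>Disjointness of the classes makes \<open>(a, b)\<close> recoverable from
  \<open>{a, b}\<close>; this passes from edges to entries of the colour array.\<close>

lemma edges_between_selected: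
  assumes "A \<subseteq> X" "B \<subseteq> Y" "X \<inter> Y = {}"
  shows "edges_between {e \<in> complete_bipartite X Y. S (c e)} A B
       = card {(a, b) \<in> A \<times> B. S (c {a, b})}"
proof -
  have "{e \<in> {e \<in> complete_bipartite X Y. S (c e)}. \<exists>a\<in>A. \<exists>b\<in>B. e = {a, b}}
      = (\<lambda>(a, b). {a, b}) ` {(a, b) \<in> A \<times> B. S (c {a, b})}" (is "?L = ?R")
  proof (rule set_eqI)
    fix e
    have "{a, b} \<in> complete_bipartite X Y" if "a \<in> A" "b \<in> B" for a b
      using that assms by (auto simp: complete_bipartite_def)
    then have "e \<in> ?L \<longleftrightarrow> (\<exists>a\<in>A. \<exists>b\<in>B. e = {a, b} \<and> S (c {a, b}))" by auto
    also have "\<dots> \<longleftrightarrow> e \<in> ?R" by (simp add: image_iff Bex_def) metis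
    finally show "e \<in> ?L \<longleftrightarrow> e \<in> ?R" .
  qed
  moreover have "inj_on (\<lambda>(a, b). {a, b}) {(a, b) \<in> A \<times> B. S (c {a, b})}"
    by (rule inj_onI) (use assms in \<open>clarsimp simp: doubleton_eq_iff, blast\<close>)
  ultimately show ?thesis by (simp add: edges_between_def card_image)
qed

section \<open>Union bound over vertices and samples\<close>

lemma measure_pmf_UN_le:
  assumes "finite I" and "\<And>i. i \<in> I \<Longrightarrow> measure_pmf.prob M (F i) \<le> q"
  shows "measure_pmf.prob M (\<Union>i\<in>I. F i) \<le> real (card I) * q"
proof -
  have "measure_pmf.prob M (\<Union>i\<in>I. F i) \<le> (\<Sum>i\<in>I. measure_pmf.prob M (F i))"
    using assms by (intro measure_pmf.finite_measure_subadditive_finite) auto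
  also have "\<dots> \<le> (\<Sum>i\<in>I. q)" using assms by (intro sum_mono)
  finally show ?thesis by simp
qed

text \<open>The non-asymptotic estimate, with the sample size still free. The first error term
  collects two tails at each of the \<open>2 * n\<close> vertices, the second one lower tail for
  each of the \<open>n ^ (2 * s)\<close> samples.\<close>

lemma prob_random_colour_subgraph_ge:
  fixes p \<epsilon> :: real and n x s :: nat
  assumes X: "finite X" "card X = n" and Y: "finite Y" "card Y = n" and disj: "X \<inter> Y = {}"
    and proper: "proper_edge_colouring (complete_bipartite X Y) c"
    and p: "0 \<le> p" "p \<le> 1" and \<epsilon>: "0 \<le> \<epsilon>" "\<epsilon> \<le> 2"
    and x: "0 < x" and s: "0 < s" and sx: "(real s)\<^sup>2 / real x \<le> \<epsilon> / 2"
  shows "measure_pmf.prob (random_colour_subgraph (complete_bipartite X Y) c p)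
          {G. (\<forall>v \<in> X \<union> Y.
                 (1 - \<epsilon>) * real n * p \<le> real (degree_in G v) \<and>
                 real (degree_in G v) \<le> (1 + \<epsilon>) * real n * p) \<and>
              (\<forall>A B. A \<subseteq> X \<longrightarrow> B \<subseteq> Y \<longrightarrow> card A = x \<longrightarrow> card B = x \<longrightarrow>
                 real (edges_between G A B) \<ge> (1 - \<epsilon>) * p * (real x)\<^sup>2)}
     \<ge> 1 - (4 * real n * exp (- (\<epsilon>\<^sup>2 * p * real n / 4))
           + real n ^ (2 * s) * exp (- (\<epsilon>\<^sup>2 * p * (real s)\<^sup>2 / 16)))"
    (is "measure_pmf.prob _ {G. ?good G} \<ge> _")
proof -
  define ok where "ok G \<longleftrightarrow> ?good G" for G
  define E where "E = complete_bipartite X Y"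
  define M where "M = Pi_pmf (c ` E) False (\<lambda>_. bernoulli_pmf p)"
  define D where "D v = c ` {e \<in> E. v \<in> e}" for v
  \<comment> \<open>Samples range over the whole classes, so one family of events handles all
    choices of \<open>A\<close> and \<open>B\<close> at once.\<close>
  define Z where "Z = ({..<s} \<rightarrow>\<^sub>E X) \<times> ({..<s} \<rightarrow>\<^sub>E Y)"
  define C where "C z = (\<lambda>u. c {fst z (fst u), snd z (snd u)}) ` ({..<s} \<times> {..<s})"
    for z :: "(nat \<Rightarrow> 'a) \<times> (nat \<Rightarrow> 'a)"
  define Low where "Low v = {S. real (card {k \<in> D v. S k}) \<le> p * real (card (D v)) - \<epsilon> * p * real n}"
    for v
  define High where "High v = {S. p * real (card (D v)) + \<epsilon> * p * real (card (D v))
      \<le> real (card {k \<in> D v. S k})}" for v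
  \<comment> \<open>Half of \<open>\<epsilon>\<close> is spent here on fluctuation; the other half
    pays for collisions through \<open>sx\<close>. This halving turns the 4 of the tail bound into
    the 16 of \<open>q\<^sub>2\<close>.\<close>
  define Few where "Few z = {S. real (card {k \<in> C z. S k})
      \<le> p * real (card (C z)) - \<epsilon> / 2 * p * (real s)\<^sup>2}" for z
  define q\<^sub>1 where "q\<^sub>1 = exp (- (\<epsilon>\<^sup>2 * p * real n / 4))"
  define q\<^sub>2 where "q\<^sub>2 = exp (- (\<epsilon>\<^sup>2 * p * (real s)\<^sup>2 / 16))"
  have finK: "finite (c ` E)" unfolding E_def using X Y by (simp add: finite_complete_bipartite)
  have D_sub: "D v \<subseteq> c ` E" for v by (auto simp: D_def)
  have card_D: "card (D v) = n" if "v \<in> X \<union> Y" for v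
    unfolding D_def E_def
    using card_incident_complete_bipartite[OF X(1) Y(1) X(2) Y(2) disj that]
      proper_edge_colouring_inj_on_incident[OF proper, of v] by (simp add: card_image)
  have C_sub: "C z \<subseteq> c ` E" if "z \<in> Z" for z
  proof -
    have "{fst z i, snd z j} \<in> E" if "i < s" "j < s" for i j
      unfolding E_def complete_bipartite_def using \<open>z \<in> Z\<close> that
      by (force simp: Z_def mem_Times_iff PiE_iff)
    then show ?thesis by (auto simp: C_def)
  qed
  have card_C: "real (card (C z)) \<le> (real s)\<^sup>2" for z
  proof -
    have "card (C z) \<le> card ({..<s} \<times> {..<s})" unfolding C_def by (intro card_image_le) simp
    then have "real (card (C z)) \<le> real (s * s)" by (simp only: of_nat_le_iff card_cartesian_product card_lessThan)
    then show ?thesis by (simp add: power2_eq_square)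
  qed
  have card_Z: "card Z = n ^ (2 * s)"
    using X Y by (simp add: Z_def card_cartesian_product card_PiE power_add mult_2)
  have finZ: "finite Z" using X Y by (simp add: Z_def finite_PiE)

  have good: "ok {e \<in> E. S (c e)}"
    if S: "S \<notin> (\<Union>v\<in>X \<union> Y. Low v) \<union> (\<Union>v\<in>X \<union> Y. High v) \<union> (\<Union>z\<in>Z. Few z)" for S
    unfolding ok_def
  proof (intro conjI ballI allI impI)
    fix v assume v: "v \<in> X \<union> Y"
    have deg: "degree_in {e \<in> E. S (c e)} v = card {k \<in> D v. S k}"
      unfolding D_def E_def by (rule degree_in_selected[OF proper])
    have "S \<notin> Low v" "S \<notin> High v" using S v by auto
    then show "(1 - \<epsilon>) * real n * p \<le> real (degree_in {e \<in> E. S (c e)} v)"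
      and "real (degree_in {e \<in> E. S (c e)} v) \<le> (1 + \<epsilon>) * real n * p"
      by (simp_all add: Low_def High_def deg card_D[OF v] algebra_simps)
  next
    fix A B assume AB: "A \<subseteq> X" "B \<subseteq> Y" "card A = x" "card B = x"
    have inE: "{a, b} \<in> complete_bipartite X Y" if "a \<in> A" "b \<in> B" for a b
      using that AB by (auto simp: complete_bipartite_def)
    interpret latin_square_sample A B "\<lambda>a b. c {a, b}" x s
    proof
      show "finite A" "finite B" using AB X Y finite_subset by auto
      show "inj_on (\<lambda>b. c {a, b}) B" if "a \<in> A" for a
      proof (rule inj_onI)
        fix b b' assume "b \<in> B" "b' \<in> B" "c {a, b} = c {a, b'}"
        then have "{a, b} = {a, b'}"
          using inj_onD[OF proper_edge_colouring_inj_on_incident[OF proper, of a]] inE that by simp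
        then show "b = b'" by (auto simp: doubleton_eq_iff)
      qed
      show "inj_on (\<lambda>a. c {a, b}) A" if "b \<in> B" for b
      proof (rule inj_onI)
        fix a a' assume "a \<in> A" "a' \<in> A" "c {a, b} = c {a', b}"
        then have "{a, b} = {a', b}"
          using inj_onD[OF proper_edge_colouring_inj_on_incident[OF proper, of b]] inE that by simp
        then show "a = a'" by (auto simp: doubleton_eq_iff)
      qed
    qed (use AB x in auto)
    have colours: "sample_colour z ` cells = C z" for z
      by (simp add: C_def cells_def sample_colour_def)
    have "samples \<subseteq> Z"
      unfolding samples_def Z_def using AB by (intro Sigma_mono PiE_mono) auto
    then have "p * real (card (sample_colour z ` cells)) - \<epsilon> / 2 * p * (real s)\<^sup>2
        \<le> real (card {k \<in> sample_colour z ` cells. S k})" if "z \<in> samples" for z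
      using S that unfolding colours by (force simp: Few_def)
    from card_selected_ge[OF p(1) this]
    have "(real x)\<^sup>2 * (p * ((real s)\<^sup>2 - real s ^ 4 / real x) - \<epsilon> / 2 * p * (real s)\<^sup>2)
        \<le> (real s)\<^sup>2 * real (edges_between {e \<in> E. S (c e)} A B)"
      by (simp add: E_def edges_between_selected[OF AB(1,2) disj])
    moreover have "(real s)\<^sup>2 * ((1 - \<epsilon>) * p * (real x)\<^sup>2)
        \<le> (real x)\<^sup>2 * (p * ((real s)\<^sup>2 - real s ^ 4 / real x) - \<epsilon> / 2 * p * (real s)\<^sup>2)"
    proof -
      define y where "y = (real s)\<^sup>2 / real x"
      have "((real s)\<^sup>2 * (real x)\<^sup>2 * p) * y \<le> ((real s)\<^sup>2 * (real x)\<^sup>2 * p) * (\<epsilon> / 2)"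
        using p sx by (intro mult_left_mono) (auto simp: y_def)
      moreover have "real s ^ 4 / real x = (real s)\<^sup>2 * y" by (simp add: y_def flip: power_add)
      ultimately show ?thesis by (simp add: algebra_simps)
    qed
    ultimately have "(real s)\<^sup>2 * ((1 - \<epsilon>) * p * (real x)\<^sup>2)
        \<le> (real s)\<^sup>2 * real (edges_between {e \<in> E. S (c e)} A B)" by linarith
    then show "(1 - \<epsilon>) * p * (real x)\<^sup>2 \<le> real (edges_between {e \<in> E. S (c e)} A B)"
      using s by simp
  qed

  have Low: "measure_pmf.prob M (Low v) \<le> q\<^sub>1" if "v \<in> X \<union> Y" for v
    unfolding M_def Low_def q\<^sub>1_def using finK D_sub p \<epsilon> card_D[OF that]
    by (intro Pi_pmf_bernoulli_lower_tail) auto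
  have High: "measure_pmf.prob M (High v) \<le> q\<^sub>1" if "v \<in> X \<union> Y" for v
    using Pi_pmf_bernoulli_upper_tail[OF finK D_sub[of v] p \<epsilon>] card_D[OF that]
    by (simp add: M_def High_def q\<^sub>1_def)
  have Few: "measure_pmf.prob M (Few z) \<le> q\<^sub>2" if "z \<in> Z" for z
    using Pi_pmf_bernoulli_lower_tail[OF finK C_sub[OF that] p _ _ card_C, of "\<epsilon> / 2"] \<epsilon>
    by (simp add: M_def Few_def q\<^sub>2_def power_divide)
  have card_XY: "card (X \<union> Y) = 2 * n" using X Y disj by (simp add: card_Un_disjoint)
  have finXY: "finite (X \<union> Y)" using X Y by simp
  have "measure_pmf.prob M (- {S. ok {e \<in> E. S (c e)}})
      \<le> measure_pmf.prob M ((\<Union>v\<in>X \<union> Y. Low v) \<union> (\<Union>v\<in>X \<union> Y. High v) \<union> (\<Union>z\<in>Z. Few z))"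
  proof (rule measure_pmf.finite_measure_mono)
    show "- {S. ok {e \<in> E. S (c e)}}
        \<subseteq> (\<Union>v\<in>X \<union> Y. Low v) \<union> (\<Union>v\<in>X \<union> Y. High v) \<union> (\<Union>z\<in>Z. Few z)"
      by (rule subsetI, rule ccontr) (use good in simp)
  qed simp
  also have "\<dots> \<le> measure_pmf.prob M (\<Union>v\<in>X \<union> Y. Low v) + measure_pmf.prob M (\<Union>v\<in>X \<union> Y. High v)
      + measure_pmf.prob M (\<Union>z\<in>Z. Few z)"
    by (intro order_trans[OF measure_Un_le] add_right_mono measure_Un_le) auto
  also have "\<dots> \<le> real (2 * n) * q\<^sub>1 + real (2 * n) * q\<^sub>1 + real (n ^ (2 * s)) * q\<^sub>2"
    unfolding card_XY[symmetric] card_Z[symmetric]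
    by (intro add_mono measure_pmf_UN_le finXY finZ Low High Few)
  finally have bad: "measure_pmf.prob M (- {S. ok {e \<in> E. S (c e)}})
      \<le> 4 * real n * q\<^sub>1 + real n ^ (2 * s) * q\<^sub>2" by (simp add: mult_ac)
  have "measure_pmf.prob (random_colour_subgraph E c p) {G. ok G}
      = measure_pmf.prob M {S. ok {e \<in> E. S (c e)}}"
    by (simp add: random_colour_subgraph_def M_def vimage_def)
  also have "\<dots> = 1 - measure_pmf.prob M (- {S. ok {e \<in> E. S (c e)}})"
    using measure_pmf.prob_compl[of "{S. ok {e \<in> E. S (c e)}}" M] by (simp add: Compl_eq_Diff_UNIV)
  finally show ?thesis using bad unfolding ok_def E_def q\<^sub>1_def q\<^sub>2_def by linarith
qed

section \<open>Choice of the sample size and passage to the limit\<close>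

text \<open>Here \<open>u\<close> is the eighth root of \<open>x / (log n / p)\<^sup>2\<close>, and the theorem is obtained with
  \<open>\<epsilon> = 8 / u\<close>: with this \<open>s\<close>, \<open>s\<^sup>2 / x\<close> is of order \<open>u ^ (-4)\<close> while \<open>\<epsilon>\<^sup>2 p s\<close> is at least \<open>64 log n\<close>.\<close>

lemma colour_sampling_error_le:
  fixes p u L :: real and n x :: nat
  assumes n: "3 \<le> n" and xn: "x \<le> n" and p: "0 < p" "p \<le> 1" and u: "4 \<le> u"
    and L: "L = ln (real n)" and ux: "real x * p\<^sup>2 = u ^ 8 * L\<^sup>2"
    and s: "s = nat \<lceil>u\<^sup>2 * L / p\<rceil>"
  shows "0 < x" "0 < s" "(real s)\<^sup>2 / real x \<le> (8 / u) / 2"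
    "4 * real n * exp (- ((8 / u)\<^sup>2 * p * real n / 4))
       + real n ^ (2 * s) * exp (- ((8 / u)\<^sup>2 * p * (real s)\<^sup>2 / 16)) \<le> 5 / real n"
proof -
  have L1: "1 \<le> L"
  proof -
    have "exp 1 \<le> real n" using exp_le n by linarith
    then show ?thesis using n by (simp add: L ln_ge_iff)
  qed
  have expL: "exp L = real n" using n by (simp add: L)
  show x: "0 < x"
  proof (rule ccontr)
    assume "\<not> 0 < x"
    then show False using ux u L1 by simp
  qed
  let ?r = "u\<^sup>2 * L / p"
  have r1: "1 \<le> ?r"
  proof -
    have "1 * 1 \<le> u\<^sup>2 * L" using u L1 by (intro mult_mono) (auto simp: one_le_power)
    then show ?thesis using p by (simp add: pos_le_divide_eq)
  qed
  have s_ge: "?r \<le> real s" unfolding s by (rule real_nat_ceiling_ge)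
  then show "0 < s" using r1 by linarith
  have "real s = of_int \<lceil>?r\<rceil>" using r1 by (simp add: s)
  \<comment> \<open>Since \<open>?r\<close> is at least 1, rounding up at most doubles it.\<close>
  then have "real s \<le> 2 * ?r" using r1 of_int_ceiling_le_add_one[of ?r] by linarith
  then have "(real s)\<^sup>2 \<le> (2 * ?r)\<^sup>2" by (intro power_mono) auto
  also have "\<dots> = 4 * u ^ 4 * L\<^sup>2 / p\<^sup>2"
    by (simp add: power_mult_distrib power_divide flip: power_mult)
  finally have "(real s)\<^sup>2 * u ^ 4 \<le> 4 * u ^ 4 * L\<^sup>2 / p\<^sup>2 * u ^ 4"
    using u by (intro mult_right_mono) auto
  also have "\<dots> = 4 * (u ^ 8 * L\<^sup>2) / p\<^sup>2" by (simp flip: power_add)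
  also have "\<dots> = 4 * real x" using p by (simp flip: ux)
  finally have "(real s)\<^sup>2 / real x \<le> 4 / u ^ 4" using x u by (simp add: field_simps)
  also have "\<dots> \<le> 4 / u"
    using u self_le_power[of u 4] by (intro divide_left_mono) auto
  finally show "(real s)\<^sup>2 / real x \<le> (8 / u) / 2" by simp

  \<comment> \<open>An exponent of \<open>2 * L\<close> makes the exponential at most
    \<open>1 / n\<^sup>2\<close>, enough against the factor \<open>4 * n\<close>. It is available
    because \<open>x \<le> n\<close> and \<open>p \<le> 1\<close> turn \<open>ux\<close> into a
    lower bound for \<open>n * p\<close>.\<close>
  have "2 * L \<le> (8 / u)\<^sup>2 * p * real n / 4"
  proof -
    have "u ^ 8 * L\<^sup>2 = (real x * p) * p" unfolding ux[symmetric] by (simp add: power2_eq_square)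
    also have "\<dots> \<le> (real x * p) * 1" using p by (intro mult_left_mono) auto
    also have "\<dots> \<le> real n * p" using p xn by simp
    finally have np: "u ^ 8 * L\<^sup>2 \<le> real n * p" .
    have "L \<le> L\<^sup>2" using L1 by (simp add: self_le_power)
    moreover have "1 * L\<^sup>2 \<le> u ^ 6 * L\<^sup>2" using u by (intro mult_right_mono) (auto simp: one_le_power)
    ultimately have "2 * L \<le> 16 * (u ^ 6 * L\<^sup>2)" using L1 by linarith
    also have "\<dots> = 16 / u\<^sup>2 * (u ^ 8 * L\<^sup>2)" using u by (simp add: field_simps flip: power_add)
    also have "\<dots> \<le> 16 / u\<^sup>2 * (real n * p)" using np by (intro mult_left_mono) auto
    finally show ?thesis by (simp add: power_divide mult_ac)
  qed
  then have "exp (- ((8 / u)\<^sup>2 * p * real n / 4)) \<le> exp (- (2 * L))" by simp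
  also have "exp (- (2 * L)) = 1 / (real n * real n)"
    using expL exp_add[of L L] by (simp add: exp_minus divide_inverse)
  finally have "4 * real n * exp (- ((8 / u)\<^sup>2 * p * real n / 4)) \<le> 4 * real n * (1 / (real n * real n))"
    by (intro mult_left_mono) auto
  then have 1: "4 * real n * exp (- ((8 / u)\<^sup>2 * p * real n / 4)) \<le> 4 / real n"
    using n by simp

  \<comment> \<open>The choice of \<open>s\<close> gives \<open>p * s \<ge> u\<^sup>2 * L\<close>,
    so the exponent is at least \<open>4 * s * L\<close>. This is twice what cancels the number of
    samples, \<open>exp (2 * s * L)\<close>, and the surplus exceeds \<open>L\<close>.\<close>
  have "real s * (u\<^sup>2 * L) \<le> real s * (p * real s)"
    using s_ge p by (intro mult_left_mono) (simp_all add: field_simps)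
  then have "4 / u\<^sup>2 * (real s * (u\<^sup>2 * L)) \<le> 4 / u\<^sup>2 * (real s * (p * real s))"
    by (rule mult_left_mono) simp
  moreover have "4 / u\<^sup>2 * (real s * (u\<^sup>2 * L)) = 4 * real s * L" using u by simp
  moreover have "4 / u\<^sup>2 * (real s * (p * real s)) = (8 / u)\<^sup>2 * p * (real s)\<^sup>2 / 16"
    by (simp add: power_divide power2_eq_square)
  ultimately have e2: "4 * real s * L \<le> (8 / u)\<^sup>2 * p * (real s)\<^sup>2 / 16" by simp
  have "real n ^ (2 * s) = exp (real (2 * s) * L)"
    by (simp only: exp_of_nat_mult expL)
  then have "real n ^ (2 * s) * exp (- ((8 / u)\<^sup>2 * p * (real s)\<^sup>2 / 16))
      = exp (real (2 * s) * L + - ((8 / u)\<^sup>2 * p * (real s)\<^sup>2 / 16))"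
    by (simp only: exp_add)
  also have "\<dots> \<le> exp (- L)"
  proof -
    have "1 * L \<le> real s * L" using \<open>0 < s\<close> L1 by (intro mult_right_mono) auto
    moreover have "real (2 * s) * L = 2 * (real s * L)" by simp
    ultimately have "real (2 * s) * L + - ((8 / u)\<^sup>2 * p * (real s)\<^sup>2 / 16) \<le> - L"
      using e2 L1 by linarith
    then show ?thesis by (simp only: exp_le_cancel_iff)
  qed
  also have "\<dots> = 1 / real n" by (simp add: exp_minus expL divide_inverse)
  finally show "4 * real n * exp (- ((8 / u)\<^sup>2 * p * real n / 4))
       + real n ^ (2 * s) * exp (- ((8 / u)\<^sup>2 * p * (real s)\<^sup>2 / 16)) \<le> 5 / real n"
    using 1 by simp
qed

theorem theorem5p1:
  fixes p :: "nat \<Rightarrow> real" and x :: "nat \<Rightarrow> nat"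
    and X Y :: "nat \<Rightarrow> 'a set" and c :: "nat \<Rightarrow> 'a set \<Rightarrow> 'c"
  assumes p: "\<And>n. 0 < p n \<and> p n \<le> 1"
    and x_le: "\<forall>\<^sub>F n in sequentially. x n \<le> n"
    and x_large: "filterlim (\<lambda>n. real (x n) / (ln (real n) / p n)\<^sup>2) at_top sequentially"
    and X: "\<And>n. finite (X n) \<and> card (X n) = n"
    and Y: "\<And>n. finite (Y n) \<and> card (Y n) = n"
    and disj: "\<And>n. X n \<inter> Y n = {}"
    and proper: "\<And>n. proper_edge_colouring (complete_bipartite (X n) (Y n)) (c n)"
  shows "\<exists>\<epsilon> :: nat \<Rightarrow> real. \<epsilon> \<longlonglongrightarrow> 0 \<and>
    (\<lambda>n. measure_pmf.prob
          (random_colour_subgraph (complete_bipartite (X n) (Y n)) (c n) (p n))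
          {G. (\<forall>v \<in> X n \<union> Y n.
                 (1 - \<epsilon> n) * real n * p n \<le> real (degree_in G v) \<and>
                 real (degree_in G v) \<le> (1 + \<epsilon> n) * real n * p n) \<and>
              (\<forall>A B. A \<subseteq> X n \<longrightarrow> B \<subseteq> Y n \<longrightarrow> card A = x n \<longrightarrow> card B = x n \<longrightarrow>
                 real (edges_between G A B) \<ge> (1 - \<epsilon> n) * p n * (real (x n))\<^sup>2)})
      \<longlonglongrightarrow> 1"
proof -
  define w where "w n = real (x n) / (ln (real n) / p n)\<^sup>2" for n
  \<comment> \<open>The eighth root is written as nested square roots so that divergence passes
    through each of them.\<close>
  define u where "u n = sqrt (sqrt (sqrt (w n)))" for n
  have u_top: "filterlim u at_top sequentially"
    unfolding u_def w_def by (intro filterlim_compose[OF sqrt_at_top] x_large)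
  show ?thesis
  proof (intro exI[of _ "\<lambda>n. 8 / u n"] conjI)
    show "(\<lambda>n. 8 / u n) \<longlonglongrightarrow> 0"
      by (rule tendsto_divide_0[OF tendsto_const filterlim_at_top_imp_at_infinity[OF u_top]])
    show "(\<lambda>n. measure_pmf.prob
          (random_colour_subgraph (complete_bipartite (X n) (Y n)) (c n) (p n))
          {G. (\<forall>v \<in> X n \<union> Y n.
                 (1 - 8 / u n) * real n * p n \<le> real (degree_in G v) \<and>
                 real (degree_in G v) \<le> (1 + 8 / u n) * real n * p n) \<and>
              (\<forall>A B. A \<subseteq> X n \<longrightarrow> B \<subseteq> Y n \<longrightarrow> card A = x n \<longrightarrow> card B = x n \<longrightarrow>
                 real (edges_between G A B) \<ge> (1 - 8 / u n) * p n * (real (x n))\<^sup>2)})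
      \<longlonglongrightarrow> 1" (is "?P \<longlonglongrightarrow> 1")
    proof (rule tendsto_sandwich)
      show "(\<lambda>n. 1 - 5 / real n) \<longlonglongrightarrow> 1"
        using tendsto_diff[OF tendsto_const lim_const_over_n[of 5], of 1] by simp
      show "(\<lambda>n. 1) \<longlonglongrightarrow> (1::real)" by simp
      show "\<forall>\<^sub>F n in sequentially. ?P n \<le> 1" by simp
      \<comment> \<open>The threshold 4 keeps \<open>8 / u n\<close> at most 2, the range in which
        the tail bounds are stated; \<open>3 \<le> n\<close> ensures
        \<open>1 \<le> ln n\<close>.\<close>
      have "\<forall>\<^sub>F n in sequentially. 4 \<le> u n" using u_top by (simp add: filterlim_at_top)
      with x_le eventually_ge_at_top[of 3]
      show "\<forall>\<^sub>F n in sequentially. 1 - 5 / real n \<le> ?P n"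
      proof eventually_elim
        case (elim n)
        let ?L = "ln (real n)"
        have w: "w n = u n ^ 8"
        proof -
          have "u n ^ 8 = (((u n)\<^sup>2)\<^sup>2)\<^sup>2" by (simp flip: power_mult)
          then show ?thesis by (simp add: u_def w_def)
        qed
        have "?L > 0" using elim by simp
        then have ux: "real (x n) * (p n)\<^sup>2 = u n ^ 8 * ?L\<^sup>2"
          using p[of n] unfolding w[symmetric] w_def by (simp add: power_divide)
        note err = colour_sampling_error_le[OF elim(2,1) _ _ elim(3) refl ux refl]
        have "1 - (4 * real n * exp (- ((8 / u n)\<^sup>2 * p n * real n / 4))
            + real n ^ (2 * nat \<lceil>(u n)\<^sup>2 * ?L / p n\<rceil>)
              * exp (- ((8 / u n)\<^sup>2 * p n * (real (nat \<lceil>(u n)\<^sup>2 * ?L / p n\<rceil>))\<^sup>2 / 16))) \<le> ?P n"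
          using X[of n] Y[of n] disj[of n] proper[of n] p[of n] elim err(1-3)
          by (intro prob_random_colour_subgraph_ge) (auto simp: field_simps)
        then show ?case using err(4) p[of n] by simp
      qed
    qed
  qed
qed

end
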